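(* Let $\mathbb F\in\{\mathbb R,\mathbb C\}$ and let $\mathcal X$ be a finite-dimensional BJ-normed space over $\mathbb F$ with $n=\dim\mathcal X\ge 3$. Then the following conditions are equivalent for $x\in\Gamma_0(\mathcal X)$: (i) $x$ corresponds to a smooth point in $\mathcal X$. (ii) The vertex $x\in\Gamma_0(\mathcal X)$ has no loop and there exist $n-2$ loopless vertices $x_3,\dots,x_n\in\Gamma_0(\mathcal X)$ such that $x^\perp\cap x_3^\perp\cap\dots\cap x_n^\perp$ is a BJ-set and, moreover, for every permutation $\sigma$ of $\{3,\dots,n\}$, setting $$\Omega_\sigma:=\Big\{y\in\Gamma_0(\mathcal X) :\ x^\perp\cap y^\perp\cap x_{\sigma(4)}^\perp\cap\dots\cap x_{\sigma(n)}^\perp\text{ is a BJ-set}\Big\},$$ one has $$x_{\sigma(4)}^\perp\cap\dots\cap x_{\sigma(n)}^\perp\cap x^\perp\cap\bigcap_{y\in\Omega_\sigma}y^\perp=\{0\}.$$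
   Context: For $u,v\in\mathcal X$, $u\perp v$ (Birkhoff--James orthogonality) means $\|u+\lambda v\|\ge\|u\|$ for all $\lambda\in\mathbb F$. $\Gamma_0(\mathcal X)$ is the directed graph whose vertices are all vectors of $\mathcal X$, with an edge $u\rightarrow v$ if and only if $u\perp v$; $0$ is the only vertex with a loop. For a vertex $u$, $u^\perp=\{v : u\rightarrow v\}$ and ${}^\perp u=\{v : v\rightarrow u\}$. Elements $u,v$ are BJ-equivalent if $u^\perp=v^\perp$ and ${}^\perp u={}^\perp v$. A norm is a BJ-norm (and the space is BJ-normed) if BJ-equivalent elements are always linearly dependent. A subset of $\Gamma_0(\mathcal X)$ is a BJ-set if any two nonzero (loopless) vertices in it are BJ-equivalent. A nonzero vector $u$ is smooth if it has a unique supporting functional ($f\in\mathcal X^*$ with $\|f\|=1$, $f(u)=\|u\|$). When $n=3$ the sets $x_{\sigma(4)}^\perp,\dots,x_{\sigma(n)}^\perp$ are absent. *)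

theory Defs
  imports "HOL-Analysis.Analysis" "Graph_Theory.Pair_Digraph" "HOL-Combinatorics.Permutations"
begin

text \<open>
  A normed space over a scalar field \<open>'f\<close>, to be instantiated with the real and the complex
  numbers. The norm is that of the type class \<^class>\<open>real_normed_vector\<close>; the first axiom
  says that the real structure of the class is the one obtained by restricting scalars.
\<close>

locale normed_space = vector_space sc
  for sc :: "'f::real_normed_field \<Rightarrow> 'a::real_normed_vector \<Rightarrow> 'a" +
  assumes scale_of_real: "sc (of_real r) u = r *\<^sub>R u"
    and norm_scale: "norm (sc c u) = norm c * norm u"

lemma normed_space_scaleR:
  "normed_space (scaleR :: real \<Rightarrow> 'a::real_normed_vector \<Rightarrow> 'a)"
  by unfold_locales (simp_all add: algebra_simps)

lemma normed_space_mult: "normed_space ((*) :: 'f::real_normed_field \<Rightarrow> 'f \<Rightarrow> 'f)"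
  by unfold_locales (simp_all add: algebra_simps norm_mult scaleR_conv_of_real)


definition bj_orthogonal ::
  "('f::real_normed_field \<Rightarrow> 'a::real_normed_vector \<Rightarrow> 'a) \<Rightarrow> 'a \<Rightarrow> 'a \<Rightarrow> bool" where
  "bj_orthogonal sc u v \<longleftrightarrow> (\<forall>c. norm (u + sc c v) \<ge> norm u)"

definition bj_digraph ::
  "('f::real_normed_field \<Rightarrow> 'a::real_normed_vector \<Rightarrow> 'a) \<Rightarrow> 'a pair_pre_digraph" where
  "bj_digraph sc = \<lparr> pverts = UNIV, parcs = {(u, v). bj_orthogonal sc u v} \<rparr>"

definition supporting_functional ::
  "('f::real_normed_field \<Rightarrow> 'a::real_normed_vector \<Rightarrow> 'a) \<Rightarrow> 'a \<Rightarrow> ('a \<Rightarrow> 'f) \<Rightarrow> bool" where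
  "supporting_functional sc u f \<longleftrightarrow>
     Vector_Spaces.linear sc (*) f \<and> bounded_linear f \<and> onorm f = 1 \<and> f u = of_real (norm u)"

definition smooth_point ::
  "('f::real_normed_field \<Rightarrow> 'a::real_normed_vector \<Rightarrow> 'a) \<Rightarrow> 'a \<Rightarrow> bool" where
  "smooth_point sc u \<longleftrightarrow> u \<noteq> 0 \<and> (\<exists>!f. supporting_functional sc u f)"


definition out_nbhd :: "'a pair_pre_digraph \<Rightarrow> 'a \<Rightarrow> 'a set" where
  "out_nbhd G u = {v \<in> pverts G. (u, v) \<in> parcs G}"

definition in_nbhd :: "'a pair_pre_digraph \<Rightarrow> 'a \<Rightarrow> 'a set" where
  "in_nbhd G u = {v \<in> pverts G. (v, u) \<in> parcs G}"

definition loopless_vertex :: "'a pair_pre_digraph \<Rightarrow> 'a \<Rightarrow> bool" where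
  "loopless_vertex G u \<longleftrightarrow> u \<in> pverts G \<and> (u, u) \<notin> parcs G"

definition bj_equivalent :: "'a pair_pre_digraph \<Rightarrow> 'a \<Rightarrow> 'a \<Rightarrow> bool" where
  "bj_equivalent G u v \<longleftrightarrow> out_nbhd G u = out_nbhd G v \<and> in_nbhd G u = in_nbhd G v"

definition bj_set :: "'a pair_pre_digraph \<Rightarrow> 'a set \<Rightarrow> bool" where
  "bj_set G S \<longleftrightarrow> S \<subseteq> pverts G \<and>
     (\<forall>u\<in>S. \<forall>v\<in>S. loopless_vertex G u \<longrightarrow> loopless_vertex G v \<longrightarrow> bj_equivalent G u v)"

lemma (in normed_space) loopless_vertex_iff: "loopless_vertex (bj_digraph sc) u \<longleftrightarrow> u \<noteq> 0"
proof -
  have "sc (- 1) u = - u"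
    using scale_minus_left[of 1 u] by simp
  then show ?thesis
    unfolding loopless_vertex_def bj_digraph_def bj_orthogonal_def
    by (auto intro: exI[of _ "- 1"])
qed

text \<open>
  Linear dependence is that of the family \<open>u, v\<close>; \<^term>\<open>dependent {u, v}\<close> would wrongly count
  \<open>u = v \<noteq> 0\<close> as independent.
\<close>

locale bj_normed_space = normed_space sc
  for sc :: "'f::real_normed_field \<Rightarrow> 'a::real_normed_vector \<Rightarrow> 'a" +
  assumes bj_equivalent_imp_dependent:
    "bj_equivalent (bj_digraph sc) u v \<Longrightarrow>
       \<exists>a b. (a \<noteq> 0 \<or> b \<noteq> 0) \<and> sc a u + sc b v = 0"

text \<open>
  Only the values \<open>z 3, \<dots>, z n\<close> of the family \<open>z\<close> are used. For \<open>n = 3\<close> the index set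
  \<open>{4..n}\<close> is empty and the intersection over it is \<^term>\<open>UNIV\<close>.
\<close>

definition omega_set :: "'a pair_pre_digraph \<Rightarrow> nat \<Rightarrow> 'a \<Rightarrow> (nat \<Rightarrow> 'a) \<Rightarrow> (nat \<Rightarrow> nat) \<Rightarrow> 'a set" where
  "omega_set G n x z \<sigma> =
     {y \<in> pverts G. bj_set G (out_nbhd G x \<inter> out_nbhd G y \<inter> (\<Inter>i\<in>{4..n}. out_nbhd G (z (\<sigma> i))))}"

definition smoothness_condition :: "'a::zero pair_pre_digraph \<Rightarrow> nat \<Rightarrow> 'a \<Rightarrow> bool" where
  "smoothness_condition G n x \<longleftrightarrow>
     loopless_vertex G x \<and>
     (\<exists>z. (\<forall>i\<in>{3..n}. loopless_vertex G (z i)) \<and>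
          bj_set G (out_nbhd G x \<inter> (\<Inter>i\<in>{3..n}. out_nbhd G (z i))) \<and>
          (\<forall>\<sigma>. \<sigma> permutes {3..n} \<longrightarrow>
             (\<Inter>i\<in>{4..n}. out_nbhd G (z (\<sigma> i))) \<inter> out_nbhd G x \<inter>
             (\<Inter>y\<in>omega_set G n x z \<sigma>. out_nbhd G y) = {0}))"

end

theory Submission
  imports Defs
begin

text \<open>
  By James' theorem \<open>u\<^sup>\<bottom>\<close> is the union of the kernels of the supporting functionals of \<open>u\<close>, so
  \<open>x\<close> is smooth iff \<open>x\<^sup>\<bottom>\<close> is a hyperplane, and in a BJ-normed space a BJ-set is a subset of a line.
  If \<open>x\<close> is smooth, take smooth \<open>x\<^sub>i\<close> whose functionals are independent of that of \<open>x\<close>; supporting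
  functionals of smooth points separate points, so the intersection over \<open>\<Omega>\<^sub>\<sigma>\<close> is trivial. If \<open>x\<close> is
  not smooth, its supporting functionals already pin down the line
  \<open>x\<^sup>\<bottom> \<inter> x\<^sub>3\<^sup>\<bottom> \<inter> \<dots> \<inter> x\<^sub>n\<^sup>\<bottom>\<close> without one of the \<open>x\<^sub>j\<close>, and this line lies in every
  \<open>y\<^sup>\<bottom>\<close> with \<open>y \<in> \<Omega>\<^sub>\<sigma>\<close>.

  Both scalar fields are treated at once, as a normed field that is a Euclidean space.
\<close>

subsection \<open>Sublinear functionals\<close>

definition sublinear :: "('a::real_vector \<Rightarrow> real) \<Rightarrow> bool" where
  "sublinear p \<longleftrightarrow> (\<forall>x y. p (x + y) \<le> p x + p y) \<and> (\<forall>r\<ge>0. \<forall>x. p (r *\<^sub>R x) \<le> r * p x)"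

lemma sublinear_add: "sublinear p \<Longrightarrow> p (x + y) \<le> p x + p y"
  by (auto simp: sublinear_def)

lemma sublinear_zero:
  assumes "sublinear p"
  shows "p 0 = 0"
proof -
  have "p (0 *\<^sub>R 0) \<le> 0 * p 0" "p (0 + 0) \<le> p 0 + p 0"
    using assms unfolding sublinear_def by blast+
  then show ?thesis by simp
qed

lemma sublinear_scale:
  assumes "sublinear p" "r \<ge> 0"
  shows "p (r *\<^sub>R x) = r * p x"
proof (cases "r = 0")
  case True
  then show ?thesis using sublinear_zero[OF assms(1)] by simp
next
  case False
  with assms have r: "r > 0" by simp
  have "p (inverse r *\<^sub>R (r *\<^sub>R x)) \<le> inverse r * p (r *\<^sub>R x)"
    using assms(1) r unfolding sublinear_def by (meson inverse_nonnegative_iff_nonnegative less_imp_le)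
  with r have "r * p x \<le> p (r *\<^sub>R x)"
    by (simp add: field_simps)
  moreover have "p (r *\<^sub>R x) \<le> r * p x"
    using assms unfolding sublinear_def by blast
  ultimately show ?thesis by simp
qed

lemma sublinear_minus: "sublinear p \<Longrightarrow> 0 \<le> p x + p (- x)"
  using sublinear_add[of p x "- x"] sublinear_zero[of p] by simp

text \<open>The largest sublinear functional below \<open>p\<close> that agrees with \<open>p\<close> at \<open>v\<close> and is linear on
  the line through \<open>v\<close>.\<close>

definition linearize_along :: "('a::real_vector \<Rightarrow> real) \<Rightarrow> 'a \<Rightarrow> 'a \<Rightarrow> real" where
  "linearize_along p v x = (INF t\<in>{0..}. p (x + t *\<^sub>R v) - t * p v)"

lemma linearize_along_le:
  assumes "sublinear p" "t \<ge> 0"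
  shows "linearize_along p v x \<le> p (x + t *\<^sub>R v) - t * p v"
  unfolding linearize_along_def
proof (rule cINF_lower)
  \<comment> \<open>The lower bound is \<open>- p (- x)\<close>:
    \<open>s * p v = p (s *\<^sub>R v)\<close> and
    \<open>s *\<^sub>R v = (x + s *\<^sub>R v) + (- x)\<close>.\<close>
  show "bdd_below ((\<lambda>t. p (x + t *\<^sub>R v) - t * p v) ` {0..})"
  proof (rule bdd_belowI2)
    fix s :: real assume "s \<in> {0..}"
    then have "s * p v = p ((x + s *\<^sub>R v) + (- x))"
      using sublinear_scale[OF assms(1), of s v] by simp
    also have "\<dots> \<le> p (x + s *\<^sub>R v) + p (- x)"
      by (rule sublinear_add[OF assms(1)])
    finally show "- p (- x) \<le> p (x + s *\<^sub>R v) - s * p v" by simp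
  qed
qed (use assms in auto)

lemma linearize_along_greatest:
  "(\<And>t. t \<ge> 0 \<Longrightarrow> m \<le> p (x + t *\<^sub>R v) - t * p v) \<Longrightarrow> m \<le> linearize_along p v x"
  unfolding linearize_along_def by (rule cINF_greatest) auto

lemma linearize_along_below: "sublinear p \<Longrightarrow> linearize_along p v x \<le> p x"
  using linearize_along_le[of p 0 v x] by simp

lemma linearize_along_minus: "sublinear p \<Longrightarrow> linearize_along p v (- v) \<le> - p v"
  using linearize_along_le[of p 1 v "- v"] sublinear_zero[of p] by simp

text \<open>Admissible parameters \<open>s\<close> for \<open>x\<close> and \<open>t\<close> for
  \<open>y\<close> give \<open>s + t\<close> for \<open>x + y\<close>; the two infima are taken one
  after the other. Homogeneity comes from replacing \<open>t\<close> by
  \<open>r * t\<close>.\<close>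

lemma sublinear_linearize_along:
  assumes p: "sublinear p"
  shows "sublinear (linearize_along p v)"
  unfolding sublinear_def
proof (intro conjI allI impI)
  let ?q = "linearize_along p v"
  fix x y
  have "?q (x + y) - (p (y + t *\<^sub>R v) - t * p v) \<le> p (x + s *\<^sub>R v) - s * p v"
    if "s \<ge> 0" "t \<ge> 0" for s t
  proof -
    have "?q (x + y) \<le> p ((x + s *\<^sub>R v) + (y + t *\<^sub>R v)) - (s + t) * p v"
      using linearize_along_le[OF p, of "s + t" v "x + y"] that by (simp add: algebra_simps)
    also have "\<dots> \<le> p (x + s *\<^sub>R v) + p (y + t *\<^sub>R v) - (s + t) * p v"
      using sublinear_add[OF p] by simp
    finally show ?thesis by (simp add: algebra_simps)
  qed
  then have "?q (x + y) - (p (y + t *\<^sub>R v) - t * p v) \<le> ?q x" if "t \<ge> 0" for t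
    using that by (intro linearize_along_greatest) auto
  then have "?q (x + y) - ?q x \<le> ?q y"
    by (intro linearize_along_greatest) (simp add: algebra_simps)
  then show "?q (x + y) \<le> ?q x + ?q y" by simp
next
  let ?q = "linearize_along p v"
  fix r :: real and x assume "0 \<le> r"
  show "?q (r *\<^sub>R x) \<le> r * ?q x"
  proof (cases "r = 0")
    case True
    then show ?thesis
      using linearize_along_below[OF p, of v 0] sublinear_zero[OF p] by simp
  next
    case False
    with \<open>0 \<le> r\<close> have r: "r > 0" by simp
    have "?q (r *\<^sub>R x) / r \<le> p (x + t *\<^sub>R v) - t * p v" if "t \<ge> 0" for t
    proof -
      have "?q (r *\<^sub>R x) \<le> p (r *\<^sub>R (x + t *\<^sub>R v)) - (r * t) * p v"
        using linearize_along_le[OF p, of "r * t" v "r *\<^sub>R x"] that r by (simp add: algebra_simps)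
      also have "\<dots> = r * (p (x + t *\<^sub>R v) - t * p v)"
        using sublinear_scale[OF p, of r "x + t *\<^sub>R v"] r
        by (simp only: right_diff_distrib mult.assoc)
      finally show ?thesis using r by (simp add: field_simps)
    qed
    then have "?q (r *\<^sub>R x) / r \<le> ?q x"
      by (rule linearize_along_greatest)
    with r show ?thesis by (simp add: field_simps)
  qed
qed

text \<open>Linearize along the vectors of \<open>T\<close> one at a time. Oddness already achieved
  survives the passage to a smaller sublinear functional \<open>q'\<close>:
  \<open>q' (- w) \<le> q (- w) = - q w \<le> - q' w\<close>, and \<open>sublinear_minus\<close>
  gives the reverse inequality.\<close>

lemma sublinear_odd_on_finite:
  assumes "finite T" "sublinear p"
  shows "\<exists>q. sublinear q \<and> (\<forall>x. q x \<le> p x) \<and> (\<forall>v\<in>T. q (- v) = - q v)"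
  using assms(1)
proof induction
  case empty
  then show ?case using assms(2) by auto
next
  case (insert v T)
  then obtain q where q: "sublinear q" "\<And>x. q x \<le> p x" "\<And>v. v \<in> T \<Longrightarrow> q (- v) = - q v"
    by auto
  let ?q = "linearize_along q v"
  have sub: "sublinear ?q" by (rule sublinear_linearize_along[OF q(1)])
  have "?q (- w) = - ?q w" if "w \<in> insert v T" for w
  proof -
    have "?q (- w) \<le> - q w"
      using that linearize_along_minus[OF q(1), of v] linearize_along_below[OF q(1), of v "- w"] q(3)
      by auto
    with linearize_along_below[OF q(1), of v w] sublinear_minus[OF sub, of w] show ?thesis
      by linarith
  qed
  moreover have "?q x \<le> p x" for x
    using linearize_along_below[OF q(1)] q(2) order_trans by blast
  ultimately show ?case using sub by blast
qed

text \<open>A sublinear functional is linear once it is odd, and the vectors at which it is odd form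
  a subspace, so oddness on a finite spanning set suffices. Linearizing along \<open>u\<close>
  beforehand keeps the value at \<open>u\<close> from dropping below \<open>p u\<close>.\<close>

theorem hahn_banach_finite:
  fixes p :: "'a::real_vector \<Rightarrow> real" and T :: "'a set"
  assumes p: "sublinear p" and T: "finite T" "span T = UNIV"
  shows "\<exists>g. linear g \<and> (\<forall>x. g x \<le> p x) \<and> g u = p u"
proof -
  obtain q where q: "sublinear q" "\<And>x. q x \<le> linearize_along p u x"
      "\<And>v. v \<in> T \<Longrightarrow> q (- v) = - q v"
    using sublinear_odd_on_finite[OF T(1) sublinear_linearize_along[OF p, of u]] by blast
  have "subspace {v. q (- v) = - q v}"
  proof (rule subspaceI)
    show "0 \<in> {v. q (- v) = - q v}" using sublinear_zero[OF q(1)] by simp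
  next
    fix a b assume "a \<in> {v. q (- v) = - q v}" "b \<in> {v. q (- v) = - q v}"
    then show "a + b \<in> {v. q (- v) = - q v}"
      using sublinear_add[OF q(1), of a b] sublinear_add[OF q(1), of "- a" "- b"]
        sublinear_minus[OF q(1), of "a + b"] by simp
  next
    fix r :: real and a assume a: "a \<in> {v. q (- v) = - q v}"
    show "r *\<^sub>R a \<in> {v. q (- v) = - q v}"
    proof (cases "r \<ge> 0")
      case True
      then show ?thesis
        using a sublinear_scale[OF q(1), of r a] sublinear_scale[OF q(1), of r "- a"] by simp
    next
      case False
      then show ?thesis
        using a sublinear_scale[OF q(1), of "- r" a] sublinear_scale[OF q(1), of "- r" "- a"] by simp
    qed
  qed
  moreover have "T \<subseteq> {v. q (- v) = - q v}" using q(3) by auto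
  ultimately have odd: "q (- v) = - q v" for v
    using span_minimal[of T "{v. q (- v) = - q v}"] T(2) by blast
  have "linear q"
  proof (rule linearI)
    fix a b
    show "q (a + b) = q a + q b"
      using sublinear_add[OF q(1), of a b] sublinear_add[OF q(1), of "- a" "- b"] odd[of a]
        odd[of b] odd[of "a + b"] by simp
  next
    fix r a
    show "q (r *\<^sub>R a) = r *\<^sub>R q a"
      using sublinear_scale[OF q(1), of r a] sublinear_scale[OF q(1), of "- r" a]
        odd[of "r *\<^sub>R a"] by (cases "r \<ge> 0") auto
  qed
  moreover have le: "q x \<le> p x" for x
    using q(2) linearize_along_below[OF p] order_trans by blast
  moreover have "q u = p u"
    using le[of u] q(2)[of "- u"] linearize_along_minus[OF p, of u] odd[of u] by simp
  ultimately show ?thesis by blast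
qed

subsection \<open>Supporting functionals\<close>

text \<open>Polarization expresses the inner product through the norm, which is
  multiplicative.\<close>

lemma inner_mult_right:
  fixes c d e :: "'f::{real_normed_field, real_inner}"
  shows "inner (c * e) (d * e) = (norm e)\<^sup>2 * inner c d"
  unfolding dot_norm distrib_right[symmetric] norm_mult
  by (simp add: power_mult_distrib algebra_simps diff_divide_distrib add_divide_distrib)

text \<open>\<open>inner c 1\<close> plays the role of the real part of \<open>c\<close>. If
  \<open>d \<noteq> d'\<close>, the factor \<open>inverse (d - d')\<close> tells them apart.\<close>

lemma inner_one_eqI:
  fixes d d' :: "'f::{real_normed_field, real_inner}"
  assumes "\<And>c. inner (c * d) 1 = inner (c * d') 1"
  shows "d = d'"
proof (rule ccontr)
  assume "d \<noteq> d'"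
  then have "inner (inverse (d - d') * (d - d')) 1 = (1::real)"
    by (simp add: dot_square_norm)
  moreover have "inner (inverse (d - d') * (d - d')) 1 = 0"
    using assms[of "inverse (d - d')"] by (simp only: right_diff_distrib inner_diff_left)
  ultimately show False by simp
qed

context normed_space
begin

lemma linear_functional_iff:
  "Vector_Spaces.linear sc (*) f \<longleftrightarrow> (\<forall>a b. f (a + b) = f a + f b) \<and> (\<forall>c a. f (sc c a) = c * f a)"
proof -
  have "vector_space ((*) :: 'f \<Rightarrow> 'f \<Rightarrow> 'f)"
    using normed_space_mult normed_space.axioms(1) by blast
  then show ?thesis
    by (simp add: Vector_Spaces.linear_iff vector_space_axioms)
qed

lemma supporting_functional_add: "supporting_functional sc u f \<Longrightarrow> f (a + b) = f a + f b"
  and supporting_functional_scale: "supporting_functional sc u f \<Longrightarrow> f (sc c a) = c * f a"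
  by (auto simp: supporting_functional_def linear_functional_iff)

lemma supporting_functional_self: "supporting_functional sc u f \<Longrightarrow> f u = of_real (norm u)"
  by (simp add: supporting_functional_def)

lemma supporting_functional_le: "supporting_functional sc u f \<Longrightarrow> norm (f a) \<le> norm a"
  using onorm[of f a] by (simp add: supporting_functional_def)

lemma supporting_functionalI:
  assumes "u \<noteq> 0" "Vector_Spaces.linear sc (*) f" "\<And>a. norm (f a) \<le> norm a"
    "f u = of_real (norm u)"
  shows "supporting_functional sc u f"
proof -
  have bl: "bounded_linear f"
  proof (rule bounded_linear_intro[where K = 1])
    fix r a
    show "f (r *\<^sub>R a) = r *\<^sub>R f a"
      using assms(2) unfolding linear_functional_iff
      by (metis scale_of_real scaleR_conv_of_real)
  qed (use assms(2,3) in \<open>auto simp: linear_functional_iff\<close>)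
  moreover have "onorm f \<le> 1"
    using onorm_bound[of 1 f] assms(3) by simp
  moreover have "1 \<le> onorm f"
    using onorm[OF bl, of u] assms(1,4) by simp
  ultimately show ?thesis
    using assms by (simp add: supporting_functional_def)
qed

lemma supporting_functional_imp_bj_orthogonal:
  assumes "supporting_functional sc u f" "f v = 0"
  shows "bj_orthogonal sc u v"
  unfolding bj_orthogonal_def
proof
  fix c
  have "f (u + sc c v) = of_real (norm u)"
    using assms by (simp add: supporting_functional_add supporting_functional_scale
        supporting_functional_self)
  then show "norm u \<le> norm (u + sc c v)"
    using supporting_functional_le[OF assms(1), of "u + sc c v"] by simp
qed

end

section \<open>James' description of orthogonality by supporting functionals\<close>

locale finite_dim_normed_space = normed_space sc + finite_dimensional_vector_space sc B
  for sc :: "'f::{real_normed_field, euclidean_space} \<Rightarrow> 'a::real_normed_vector \<Rightarrow> 'a" and B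
begin

lemma sc_scaleR: "sc (r *\<^sub>R c) v = r *\<^sub>R sc c v"
  by (metis scale_of_real scale_scale scaleR_conv_of_real)

lemma sum_Basis_sc: "sc c v = (\<Sum>e\<in>Basis. inner c e *\<^sub>R sc e v)"
  by (subst euclidean_representation[symmetric, of c]) (simp add: scale_sum_left sc_scaleR)

lemma sum_representation: "(\<Sum>b\<in>B. sc (representation B v b) b) = v"
  using sum_representation_eq[OF independent_Basis _ finite_Basis order_refl, of v]
  by (simp add: span_Basis)

text \<open>\<open>Basis\<close> is the real basis of the scalar field and \<open>B\<close> the
  basis over that field; their products form the finite real spanning set required by
  \<open>hahn_banach_finite\<close>.\<close>

lemma real_span_Basis: "real_vector.span ((\<lambda>(e, b). sc e b) ` (Basis \<times> B)) = UNIV"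
proof -
  have "v \<in> real_vector.span ((\<lambda>(e, b). sc e b) ` (Basis \<times> B))" for v
    by (subst sum_representation[symmetric, of v], subst sum_Basis_sc)
      (intro real_vector.span_sum real_vector.span_scale real_vector.span_base, auto)
  then show ?thesis by blast
qed

text \<open>\<open>f v\<close> represents the real functional \<open>\<lambda>c. g (sc c v)\<close> on the scalars.\<close>

lemma complexify_functional:
  fixes g :: "'a \<Rightarrow> real"
  assumes "linear g"
  shows "\<exists>f. Vector_Spaces.linear sc (*) f \<and> (\<forall>c v. inner (c * f v) 1 = g (sc c v))"
proof -
  interpret g: linear g by fact
  define f :: "'a \<Rightarrow> 'f" where "f v = (\<Sum>e\<in>Basis. g (sc e v) *\<^sub>R inverse e)" for v
  \<comment> \<open>Since \<open>norm e = 1\<close>, multiplying both arguments by \<open>e\<close>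
    preserves the inner product. Thus the elements \<open>inverse e\<close> recover the coordinates
    of \<open>c\<close>.\<close>
  have inv: "inner (c * inverse e) 1 = inner c e" if "e \<in> Basis" for c e :: 'f
    using inner_mult_right[of "c * inverse e" e 1] that by (simp add: nonzero_Basis mult.assoc)
  have f: "inner (c * f v) 1 = g (sc c v)" for c v
  proof -
    have "inner (c * f v) 1 = (\<Sum>e\<in>Basis. g (sc e v) * inner (c * inverse e) 1)"
      by (simp add: f_def sum_distrib_left inner_sum_left)
    also have "\<dots> = (\<Sum>e\<in>Basis. inner c e * g (sc e v))"
      by (intro sum.cong) (auto simp: inv)
    also have "\<dots> = g (sc c v)"
      unfolding sum_Basis_sc[of c v] by (simp only: g.sum g.scale real_scaleR_def)
    finally show ?thesis .
  qed
  have "f (a + b) = f a + f b" for a b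
    by (rule inner_one_eqI) (simp only: f scale_right_distrib g.add distrib_left inner_add_left)
  moreover have "f (sc k a) = k * f a" for k a
    by (rule inner_one_eqI) (simp only: f scale_scale mult.assoc[symmetric])
  ultimately show ?thesis using f by (auto simp: linear_functional_iff)
qed

text \<open>Apply Hahn-Banach to the distance \<open>p\<close> from the line through
  \<open>v\<close>. Orthogonality says exactly \<open>p u = norm u\<close>, while \<open>p\<close>
  vanishes on the line and so forces \<open>g\<close> to vanish there.\<close>

theorem bj_orthogonal_imp_supporting_functional:
  assumes u: "u \<noteq> 0" and uv: "bj_orthogonal sc u v"
  shows "\<exists>f. supporting_functional sc u f \<and> f v = 0"
proof -
  define p where "p x = (INF c. norm (x + sc c v))" for x
  have p_le: "p x \<le> norm (x + sc c v)" for x c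
    unfolding p_def by (rule cINF_lower) (auto intro: bdd_belowI2[of _ 0])
  have p_greatest: "m \<le> p x" if "\<And>c. m \<le> norm (x + sc c v)" for m x
    unfolding p_def using that by (intro cINF_greatest) auto
  have "sublinear p"
    unfolding sublinear_def
  proof (intro conjI allI impI)
    fix x y
    have "p (x + y) - norm (y + sc d v) \<le> norm (x + sc c v)" for c d
    proof -
      have "p (x + y) \<le> norm ((x + sc c v) + (y + sc d v))"
        using p_le[of "x + y" "c + d"] by (simp add: algebra_simps)
      also have "\<dots> \<le> norm (x + sc c v) + norm (y + sc d v)" by (rule norm_triangle_ineq)
      finally show ?thesis by simp
    qed
    then have "p (x + y) - norm (y + sc d v) \<le> p x" for d
      by (intro p_greatest) auto
    then have "p (x + y) - p x \<le> p y"
      by (intro p_greatest) (simp add: algebra_simps)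
    then show "p (x + y) \<le> p x + p y" by simp
  next
    fix r :: real and x assume "r \<ge> 0"
    show "p (r *\<^sub>R x) \<le> r * p x"
    proof (cases "r = 0")
      case True
      then show ?thesis using p_le[of 0 0] by simp
    next
      case False
      with \<open>r \<ge> 0\<close> have r: "r > 0" by simp
      have "p (r *\<^sub>R x) / r \<le> norm (x + sc c v)" for c
      proof -
        have "p (r *\<^sub>R x) \<le> norm (r *\<^sub>R (x + sc c v))"
          using p_le[of "r *\<^sub>R x" "r *\<^sub>R c"] by (simp add: sc_scaleR scaleR_right_distrib)
        then show ?thesis using r by (simp only: norm_scaleR) (simp add: field_simps)
      qed
      then have "p (r *\<^sub>R x) / r \<le> p x" by (rule p_greatest)
      then show ?thesis using r by (simp add: field_simps)
    qed
  qed
  then obtain g where g: "linear g" "\<And>x. g x \<le> p x" "g u = p u"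
    using hahn_banach_finite[OF _ _ real_span_Basis, of p u] finite_Basis by auto
  obtain f where f: "Vector_Spaces.linear sc (*) f" "\<And>c v. inner (c * f v) 1 = g (sc c v)"
    using complexify_functional[OF g(1)] by blast
  have p_norm: "p x \<le> norm x" for x using p_le[of x 0] by simp
  have bound: "norm (f x) \<le> norm x" for x
  proof (cases "f x = 0")
    case False
    \<comment> \<open>This unimodular scalar rotates \<open>f x\<close> onto the nonnegative reals,
      where the norm equals the real part.\<close>
    define c where "c = of_real (norm (f x)) / f x"
    have "norm c = 1" "c * f x = of_real (norm (f x))"
      using False by (auto simp: c_def norm_divide)
    then have "norm (f x) = inner (c * f x) 1"
      by (simp add: of_real_def dot_square_norm)
    also have "\<dots> \<le> norm (sc c x)" unfolding f(2) using g(2) p_norm order_trans by blast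
    also have "\<dots> = norm x" using \<open>norm c = 1\<close> by (simp add: norm_scale)
    finally show ?thesis .
  qed simp
  have "g u = norm u"
    unfolding g(3) using p_norm[of u] p_greatest[of "norm u" u] uv
    by (simp add: bj_orthogonal_def)
  then have inner_u: "inner (f u) 1 = norm u" using f(2)[of 1 u] by simp
  \<comment> \<open>The real part of \<open>f u\<close> is \<open>norm u\<close> and its modulus is
    at most \<open>norm u\<close>; expanding the squared distance shows that this forces
    \<open>f u = of_real (norm u)\<close>.\<close>
  have "(norm (f u - of_real (norm u)))\<^sup>2 =
      inner (f u) (f u) - 2 * norm u * inner (f u) 1 + (norm u)\<^sup>2 * inner (1::'f) 1"
    unfolding power2_norm_eq_inner[of "f u - of_real (norm u)"]
    by (simp only: of_real_def inner_diff_left inner_diff_right inner_scaleR_left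
        inner_scaleR_right inner_commute[of 1 "f u"]) (simp add: algebra_simps power2_eq_square)
  also have "\<dots> = (norm (f u))\<^sup>2 - (norm u)\<^sup>2"
    unfolding inner_u by (simp add: dot_square_norm power2_eq_square)
  also have "\<dots> \<le> 0" using bound[of u] by simp
  finally have fu: "f u = of_real (norm u)" by simp
  have g_le: "g (sc c v) \<le> 0" for c
    using g(2)[of "sc c v"] p_le[of "sc c v" "- c"] by simp
  have "g (sc c v) = 0" for c
    using g_le[of c] g_le[of "- c"] linear_neg[OF g(1), of "sc c v"] by simp
  then have "f v = 0" using f(2) by - (rule inner_one_eqI, simp)
  then show ?thesis using supporting_functionalI[OF u f(1) bound fu] by blast
qed

lemma bj_orthogonal_iff:
  "u \<noteq> 0 \<Longrightarrow> bj_orthogonal sc u v \<longleftrightarrow> (\<exists>f. supporting_functional sc u f \<and> f v = 0)"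
  using bj_orthogonal_imp_supporting_functional supporting_functional_imp_bj_orthogonal by blast

lemma supporting_functional_exists: "u \<noteq> 0 \<Longrightarrow> \<exists>f. supporting_functional sc u f"
  using bj_orthogonal_imp_supporting_functional[of u 0] by (auto simp: bj_orthogonal_def)

end

section \<open>Smooth points whose functional does not vanish at a given vector\<close>

lemma power2_norm_add_scaleR:
  fixes u v :: "'f::real_inner"
  shows "(norm (u + t *\<^sub>R v))\<^sup>2 = (norm u)\<^sup>2 + t * (2 * inner u v) + t\<^sup>2 * (norm v)\<^sup>2"
  unfolding power2_norm_eq_inner
  by (simp add: inner_add inner_commute algebra_simps power2_eq_square)

lemma linear_coefficient_zero:
  fixes a c :: real
  assumes "\<forall>\<^sub>F t in nhds 0. 0 \<le> t * a + t\<^sup>2 * c"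
  shows "a = 0"
proof -
  obtain d where d: "d > 0" "\<And>t. dist t 0 < d \<Longrightarrow> 0 \<le> t * a + t\<^sup>2 * c"
    using assms unfolding eventually_nhds_metric by blast
  have "((\<lambda>t. t * a + t\<^sup>2 * c) has_real_derivative a) (at 0)"
    by (auto intro!: derivative_eq_intros)
  from DERIV_local_min[OF this d(1)] show ?thesis
    using d(2) by (simp add: dist_real_def)
qed

context finite_dim_normed_space
begin

text \<open>At a local minimum of \<open>K |y - w|\<^sup>2 - \<parallel>y\<parallel>\<close>, with \<open>|\<cdot>|\<close> a Euclidean norm in coordinates,
  the norm is touched from above by a differentiable function, so \<open>y\<close> is smooth; for large \<open>K\<close> the
  minimum lies close to \<open>w\<close>.\<close>

theorem smooth_point_not_vanishing_at:
  assumes w: "w \<noteq> 0"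
  shows "\<exists>y f. smooth_point sc y \<and> supporting_functional sc y f \<and> f w \<noteq> 0"
proof -
  \<comment> \<open>With \<open>\<rho> * M = norm w / 4\<close>, coordinates within
    \<open>\<rho>\<close> of those of \<open>w\<close> give vectors within \<open>norm w / 4\<close>
    of \<open>w\<close>. \<open>K\<close> is chosen so that
    \<open>K * \<rho>\<^sup>2 = 2 * (\<rho> * M)\<close>: on the boundary of the box the penalty
    exceeds any possible gain in norm.\<close>
  define M where "M = 1 + (\<Sum>b\<in>B. norm b)"
  define \<rho> where "\<rho> = norm w / (4 * M)"
  define K where "K = 2 * M / \<rho>"
  define a where "a = representation B w"
  define val where "val c = (\<Sum>b\<in>B. sc (c b) b)" for c :: "'a \<Rightarrow> 'f"
  define \<Phi> where "\<Phi> c = K * (\<Sum>b\<in>B. (norm (c b - a b))\<^sup>2) - norm (val c)" for c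
  \<comment> \<open>A box over all indices of type \<open>'a\<close>, compact as a product of balls;
    \<open>\<Phi>\<close> sees only the coordinates in \<open>B\<close>.\<close>
  define S where "S = (\<Pi>\<^sub>E b\<in>UNIV. cball (a b) \<rho>)"
  have M: "M \<ge> 1" by (simp add: M_def sum_nonneg)
  then have \<rho>: "\<rho> > 0" using w by (simp add: \<rho>_def)
  have K: "K > 0" using M \<rho> by (simp add: K_def)
  have \<rho>M: "\<rho> * M = norm w / 4" using M by (simp add: \<rho>_def)
  have K\<rho>: "K * \<rho>\<^sup>2 = 2 * (\<rho> * M)" using \<rho> by (simp add: K_def power2_eq_square)
  have val_rep: "val (representation B v) = v" for v
    unfolding val_def by (rule sum_representation)
  have S_iff: "c \<in> S \<longleftrightarrow> (\<forall>b. norm (c b - a b) \<le> \<rho>)" for c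
    by (auto simp: S_def PiE_UNIV_domain dist_norm norm_minus_commute)
  have "compact S"
    using compactin_PiE[of "\<lambda>_. euclidean" UNIV "\<lambda>b. cball (a b) \<rho>"]
    by (simp add: S_def euclidean_product_topology)
  moreover have "a \<in> S" using \<rho> by (simp add: S_iff)
  moreover have "continuous_on S \<Phi>"
  proof -
    have coord: "continuous_on S (\<lambda>c. c b)" for b :: 'a
      by (rule continuous_on_subset[OF continuous_on_product_coordinates subset_UNIV])
    have "bounded_linear (\<lambda>k. sc k b)" for b
      by (rule bounded_linear_intro[where K = "norm b"])
        (simp_all add: scale_left_distrib sc_scaleR norm_scale)
    then have "continuous_on S (\<lambda>c. sc (c b) b)" for b
      using bounded_linear.continuous_on coord by blast
    then show ?thesis
      unfolding \<Phi>_def val_def by (intro continuous_intros coord)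
  qed
  ultimately obtain c0 where c0: "c0 \<in> S" "\<And>c. c \<in> S \<Longrightarrow> \<Phi> c0 \<le> \<Phi> c"
    using continuous_attains_inf[of S \<Phi>] by blast
  define y where "y = val c0"
  have yw: "norm (y - w) \<le> norm w / 4"
  proof -
    have "y - w = (\<Sum>b\<in>B. sc (c0 b - a b) b)"
      unfolding y_def by (subst val_rep[symmetric, of w])
        (simp add: val_def a_def sum_subtractf scale_left_diff_distrib)
    also have "norm \<dots> \<le> (\<Sum>b\<in>B. \<rho> * norm b)"
      using c0(1) by (intro sum_norm_le) (simp add: norm_scale S_iff mult_right_mono)
    also have "\<dots> \<le> \<rho> * M"
      using \<rho> by (simp add: M_def sum_distrib_left[symmetric])
    finally show ?thesis using \<rho>M by simp
  qed
  \<comment> \<open>Comparing \<open>\<Phi> c0\<close> with \<open>\<Phi> a\<close> keeps the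
    minimizer off the boundary in every coordinate of \<open>B\<close>, so small perturbations in
    all directions stay in \<open>S\<close>.\<close>
  have interior: "norm (c0 b - a b) < \<rho>" if "b \<in> B" for b
  proof -
    have "K * (norm (c0 b - a b))\<^sup>2 \<le> K * (\<Sum>b\<in>B. (norm (c0 b - a b))\<^sup>2)"
      using K that finite_Basis by (intro mult_left_mono member_le_sum) auto
    also have "\<dots> \<le> norm y - norm w"
      using c0(2)[OF \<open>a \<in> S\<close>] val_rep[of w] by (simp add: \<Phi>_def y_def a_def)
    also have "\<dots> \<le> norm (y - w)" by (rule norm_triangle_ineq2)
    also have "\<dots> \<le> \<rho> * M" using yw \<rho>M by simp
    also have "\<dots> < K * \<rho>\<^sup>2" using K\<rho> M \<rho> by simp
    finally have "(norm (c0 b - a b))\<^sup>2 < \<rho>\<^sup>2" using K by simp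
    then show ?thesis using \<rho> power_less_imp_less_base by fastforce
  qed
  \<comment> \<open>First-order condition at the minimum. The right-hand side does not mention
    \<open>f\<close>, which yields uniqueness of the supporting functional.\<close>
  have deriv: "inner (f h) 1 =
      2 * K * (\<Sum>b\<in>B. inner (c0 b - a b) (representation B h b))"
    if f: "supporting_functional sc y f" for f h
  proof -
    define \<eta> where "\<eta> = representation B h"
    define A where "A = 2 * K * (\<Sum>b\<in>B. inner (c0 b - a b) (\<eta> b))"
    define C where "C = K * (\<Sum>b\<in>B. (norm (\<eta> b))\<^sup>2)"
    have "\<forall>\<^sub>F t in nhds 0. \<forall>b\<in>B. norm (c0 b - a b + t *\<^sub>R \<eta> b) < \<rho>"
    proof (intro eventually_ball_finite finite_Basis ballI)
      fix b assume "b \<in> B"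
      have "((\<lambda>t. norm (c0 b - a b + t *\<^sub>R \<eta> b)) \<longlongrightarrow> norm (c0 b - a b + 0 *\<^sub>R \<eta> b)) (nhds 0)"
        by (intro tendsto_intros filterlim_ident)
      then show "\<forall>\<^sub>F t in nhds 0. norm (c0 b - a b + t *\<^sub>R \<eta> b) < \<rho>"
        using interior[OF \<open>b \<in> B\<close>] order_tendstoD(2) by fastforce
    qed
    then have "\<forall>\<^sub>F t in nhds 0. 0 \<le> t * (A - inner (f h) 1) + t\<^sup>2 * C"
    proof eventually_elim
      case (elim t)
      define c where "c b = c0 b + t *\<^sub>R \<eta> b" for b
      have "norm (c b - a b) \<le> \<rho>" for b
      proof (cases "b \<in> B")
        case True
        then show ?thesis using elim by (auto simp: c_def algebra_simps less_imp_le)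
      next
        case False
        then have "\<eta> b = 0" using representation_ne_zero \<eta>_def by blast
        then show ?thesis using c0(1) by (simp add: c_def S_iff)
      qed
      then have "\<Phi> c0 \<le> \<Phi> c" using c0(2) S_iff by blast
      moreover have "val c = y + t *\<^sub>R h"
        by (subst val_rep[symmetric, of h])
          (simp add: c_def y_def val_def \<eta>_def scale_left_distrib sum.distrib sc_scaleR
            scaleR_sum_right)
      moreover have "K * (\<Sum>b\<in>B. (norm (c b - a b))\<^sup>2) =
          K * (\<Sum>b\<in>B. (norm (c0 b - a b))\<^sup>2) + t * A + t\<^sup>2 * C"
      proof -
        have "(norm (c b - a b))\<^sup>2 =
            (norm (c0 b - a b))\<^sup>2 + t * (2 * inner (c0 b - a b) (\<eta> b)) + t\<^sup>2 * (norm (\<eta> b))\<^sup>2" for b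
          using power2_norm_add_scaleR[of "c0 b - a b" t "\<eta> b"] by (simp add: c_def algebra_simps)
        then have "(\<Sum>b\<in>B. (norm (c b - a b))\<^sup>2) = (\<Sum>b\<in>B. (norm (c0 b - a b))\<^sup>2) +
            t * (2 * (\<Sum>b\<in>B. inner (c0 b - a b) (\<eta> b))) + t\<^sup>2 * (\<Sum>b\<in>B. (norm (\<eta> b))\<^sup>2)"
          by (simp only: sum.distrib sum_distrib_left)
        then show ?thesis
          by (simp only: A_def C_def distrib_left) (simp only: mult_ac)
      qed
      ultimately have "norm (y + t *\<^sub>R h) \<le> norm y + t * A + t\<^sup>2 * C"
        by (simp add: \<Phi>_def y_def)
      moreover have "norm y + t * inner (f h) 1 \<le> norm (y + t *\<^sub>R h)"
      proof -
        have "f (y + sc (of_real t) h) = norm y *\<^sub>R 1 + t *\<^sub>R f h"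
          by (simp add: supporting_functional_add[OF f] supporting_functional_scale[OF f]
              supporting_functional_self[OF f] scaleR_conv_of_real)
        then have "inner (f (y + t *\<^sub>R h)) 1 = norm y + t * inner (f h) 1"
          by (simp add: scale_of_real inner_add_left dot_square_norm)
        then show ?thesis
          using norm_cauchy_schwarz[of "f (y + t *\<^sub>R h)" 1]
            supporting_functional_le[OF f, of "y + t *\<^sub>R h"] by simp
      qed
      ultimately show ?case by (simp add: algebra_simps)
    qed
    then show ?thesis
      using linear_coefficient_zero by (fastforce simp: A_def \<eta>_def)
  qed
  have "y \<noteq> 0" using yw w by auto
  then obtain f where f: "supporting_functional sc y f"
    using supporting_functional_exists by blast
  have "f' = f" if f': "supporting_functional sc y f'" for f'
  proof
    fix h
    show "f' h = f h"
    proof (rule inner_one_eqI)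
      fix c
      show "inner (c * f' h) 1 = inner (c * f h) 1"
        using deriv[OF f, of "sc c h"] deriv[OF f', of "sc c h"]
        by (simp add: supporting_functional_scale[OF f] supporting_functional_scale[OF f'])
    qed
  qed
  then have "smooth_point sc y"
    unfolding smooth_point_def using \<open>y \<noteq> 0\<close> f by blast
  \<comment> \<open>Otherwise \<open>norm y \<le> norm (y - w) \<le> norm w / 4\<close>, although
    \<open>y\<close> has norm at least three quarters of \<open>norm w\<close>.\<close>
  moreover have "f w \<noteq> 0"
  proof
    assume "f w = 0"
    then have "f (y - w) = of_real (norm y)"
      using supporting_functional_add[OF f, of "y - w" w] supporting_functional_self[OF f] by simp
    then have "norm y \<le> norm (y - w)"
      using supporting_functional_le[OF f, of "y - w"] by simp
    moreover have "norm w - norm y \<le> norm (y - w)"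
      using norm_triangle_ineq2[of w y] by (simp add: norm_minus_commute)
    moreover have "0 < norm w" using w by simp
    ultimately show False using yw by linarith
  qed
  ultimately show ?thesis using f by blast
qed

end

subsection \<open>Common kernels of functionals\<close>

context finite_dim_normed_space
begin

lemma linear_functional_zero: "Vector_Spaces.linear sc (*) f \<Longrightarrow> f 0 = 0"
  unfolding linear_functional_iff by (metis scale_zero_left mult_zero_left)

lemma subspace_kernel: "Vector_Spaces.linear sc (*) f \<Longrightarrow> subspace {v. f v = 0}"
  by (rule subspaceI) (auto simp: linear_functional_iff linear_functional_zero)

text \<open>A single \<open>s\<close> in \<open>S\<close> with \<open>f s \<noteq> 0\<close> spans
  \<open>S\<close> together with the kernel part: subtract \<open>f v / f s\<close> times
  \<open>s\<close> from \<open>v\<close>.\<close>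

lemma dim_le_dim_kernel:
  assumes f: "Vector_Spaces.linear sc (*) f" and S: "subspace S"
  shows "dim S \<le> dim (S \<inter> {v. f v = 0}) + 1"
proof (cases "S \<subseteq> {v. f v = 0}")
  case True
  then show ?thesis by (simp add: Int_absorb2)
next
  case False
  then obtain s where s: "s \<in> S" "f s \<noteq> 0" by blast
  have "S \<subseteq> span (insert s (S \<inter> {v. f v = 0}))"
  proof
    fix v assume "v \<in> S"
    define k where "k = f v / f s"
    have "f (v + sc (- k) s) = 0"
      using f s(2) by (simp add: linear_functional_iff k_def del: scale_minus_left)
    moreover have "v + sc (- k) s \<in> S"
      using S \<open>v \<in> S\<close> s(1) by (intro subspace_add subspace_scale)
    ultimately have "v + sc (- k) s + sc k s \<in> span (insert s (S \<inter> {v. f v = 0}))"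
      by (intro span_add span_scale span_base) auto
    then show "v \<in> span (insert s (S \<inter> {v. f v = 0}))" by simp
  qed
  then have "dim S \<le> dim (insert s (S \<inter> {v. f v = 0}))" by (rule dim_mono)
  then show ?thesis by (simp add: dim_insert split: if_splits)
qed

lemma dim_kernel_less:
  assumes f: "Vector_Spaces.linear sc (*) f" and S: "subspace S" and s: "s \<in> S" "f s \<noteq> 0"
  shows "dim (S \<inter> {v. f v = 0}) < dim S"
proof (rule dim_psubset)
  have eq: "span (S \<inter> {v. f v = 0}) = S \<inter> {v. f v = 0}" "span S = S"
    using S f by (simp_all add: span_eq_iff subspace_inter subspace_kernel)
  show "span (S \<inter> {v. f v = 0}) \<subset> span S" unfolding eq using s by auto
qed

lemma dim_common_kernel:
  assumes "finite F" "\<And>f. f \<in> F \<Longrightarrow> Vector_Spaces.linear sc (*) f"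
  shows "subspace {v. \<forall>f\<in>F. f v = 0} \<and> dim UNIV \<le> dim {v. \<forall>f\<in>F. f v = 0} + card F"
  using assms
proof (induction F)
  case (insert f F)
  let ?K = "{v. \<forall>f\<in>F. f v = 0}"
  have eq: "{v. \<forall>g\<in>insert f F. g v = 0} = ?K \<inter> {v. f v = 0}" by auto
  have "subspace ?K" "dim UNIV \<le> dim ?K + card F" using insert by auto
  moreover have "dim ?K \<le> dim (?K \<inter> {v. f v = 0}) + 1"
    using insert.prems \<open>subspace ?K\<close> by (intro dim_le_dim_kernel) auto
  moreover have "subspace (?K \<inter> {v. f v = 0})"
    using insert.prems \<open>subspace ?K\<close> by (intro subspace_inter subspace_kernel) auto
  ultimately show ?case
    unfolding eq using insert.hyps by simp
qed simp

lemma common_zero_exists: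
  assumes "finite F" "\<And>f. f \<in> F \<Longrightarrow> Vector_Spaces.linear sc (*) f" "card F < dim UNIV"
  shows "\<exists>v. v \<noteq> 0 \<and> (\<forall>f\<in>F. f v = 0)"
proof (rule ccontr)
  assume "\<nexists>v. v \<noteq> 0 \<and> (\<forall>f\<in>F. f v = 0)"
  then have "{v. \<forall>f\<in>F. f v = 0} \<subseteq> {0}" by auto
  then have "dim {v. \<forall>f\<in>F. f v = 0} = 0" by simp
  with dim_common_kernel[OF assms(1,2)] assms(3) show False by simp
qed

text \<open>Induction on \<open>F\<close>: subtract from \<open>f\<close> a multiple
  \<open>k\<close> of the new functional \<open>h\<close> so that the rest vanishes on the common
  kernel of \<open>F\<close>. If some \<open>s\<close> in that kernel has
  \<open>h s \<noteq> 0\<close>, then \<open>k = f s / h s\<close>; otherwise \<open>k = 0\<close>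
  works.\<close>

lemma functional_in_span:
  assumes "finite F" "\<And>g. g \<in> F \<Longrightarrow> Vector_Spaces.linear sc (*) g"
    and "Vector_Spaces.linear sc (*) f" "\<And>v. \<forall>g\<in>F. g v = 0 \<Longrightarrow> f v = 0"
  shows "\<exists>b. \<forall>v. f v = (\<Sum>g\<in>F. b g * g v)"
  using assms
proof (induction F arbitrary: f)
  case empty
  then show ?case by simp
next
  case (insert h F)
  have h: "Vector_Spaces.linear sc (*) h" using insert.prems(1) by simp
  obtain k where k: "\<And>v. \<forall>g\<in>F. g v = 0 \<Longrightarrow> f v - k * h v = 0"
  proof (cases "\<exists>s. (\<forall>g\<in>F. g s = 0) \<and> h s \<noteq> 0")
    case True
    then obtain s where s: "\<forall>g\<in>F. g s = 0" "h s \<noteq> 0" by blast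
    have "f v - f s / h s * h v = 0" if v: "\<forall>g\<in>F. g v = 0" for v
    proof -
      define k where "k = - (h v / h s)"
      have lin: "g (v + sc k s) = g v + k * g s" if "Vector_Spaces.linear sc (*) g" for g
        using that by (simp add: linear_functional_iff)
      have "g (v + sc k s) = 0" if "g \<in> insert h F" for g
        using lin[OF insert.prems(1)[OF that]] that s v by (auto simp: k_def)
      then have "f (v + sc k s) = 0" using insert.prems(3) by blast
      then show ?thesis using lin[OF insert.prems(2)] by (simp add: k_def)
    qed
    then show ?thesis by (rule that)
  next
    case False
    then have "f v - 0 * h v = 0" if "\<forall>g\<in>F. g v = 0" for v
      using insert.prems(3) that by auto
    then show ?thesis by (rule that)
  qed
  have "Vector_Spaces.linear sc (*) (\<lambda>v. f v - k * h v)"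
    using insert.prems(2) h by (simp add: linear_functional_iff algebra_simps)
  then obtain b where b: "\<And>v. f v - k * h v = (\<Sum>g\<in>F. b g * g v)"
    using insert.IH[of "\<lambda>v. f v - k * h v"] insert.prems(1) k by auto
  have "f v = (\<Sum>g\<in>insert h F. (b(h := k)) g * g v)" for v
  proof -
    have "(\<Sum>g\<in>insert h F. (b(h := k)) g * g v) = k * h v + (\<Sum>g\<in>F. (b(h := k)) g * g v)"
      using insert.hyps by simp
    also have "(\<Sum>g\<in>F. (b(h := k)) g * g v) = (\<Sum>g\<in>F. b g * g v)"
      using insert.hyps by (intro sum.cong) auto
    finally show ?thesis using b[of v] by (simp add: algebra_simps)
  qed
  then show ?case by blast
qed

lemma dim_le_1_subset_line:
  assumes "dim S \<le> 1"
  shows "\<exists>v. S \<subseteq> span {v}"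
proof -
  obtain C where C: "independent C" "S \<subseteq> span C" "card C = dim S"
    using basis_exists[of S] by metis
  have "finite C" by (rule finiteI_independent[OF C(1)])
  with C(3) assms have "\<forall>u\<in>C. \<forall>v\<in>C. u = v"
    by (simp flip: card_le_Suc0_iff_eq)
  then obtain v where "C \<subseteq> {v}" by blast
  then show ?thesis using C(2) span_mono by blast
qed

text \<open>Greedy choice: each new functional is nonzero at some vector of the current intersection
  and lowers its dimension. Once the intersection is trivial any smooth point serves;
  \<open>w\<close> guarantees that one exists, and truncated subtraction makes the bound
  hold.\<close>

lemma smooth_family_exists:
  assumes "finite I" "subspace W" "w \<noteq> (0::'a)"
  shows "\<exists>z g. (\<forall>i\<in>I. smooth_point sc (z i) \<and> supporting_functional sc (z i) (g i)) \<and>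
    subspace (W \<inter> {v. \<forall>i\<in>I. g i v = 0}) \<and> dim (W \<inter> {v. \<forall>i\<in>I. g i v = 0}) \<le> dim W - card I"
  using assms(1)
proof induction
  case empty
  then show ?case using assms(2) by simp
next
  case (insert i I)
  then obtain z g where zg: "\<And>i. i \<in> I \<Longrightarrow> smooth_point sc (z i) \<and> supporting_functional sc (z i) (g i)"
    and sub: "subspace (W \<inter> {v. \<forall>i\<in>I. g i v = 0})"
    and dim: "dim (W \<inter> {v. \<forall>i\<in>I. g i v = 0}) \<le> dim W - card I"
    by blast
  let ?K = "W \<inter> {v. \<forall>i\<in>I. g i v = 0}"
  obtain y h where y: "smooth_point sc y" "supporting_functional sc y h"
    and less: "dim (?K \<inter> {v. h v = 0}) \<le> dim ?K - 1"
  proof (cases "?K \<subseteq> {0}")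
    case True
    obtain y h where y: "smooth_point sc y" "supporting_functional sc y h"
      using smooth_point_not_vanishing_at[OF assms(3)] by blast
    have "?K \<inter> {v. h v = 0} \<subseteq> {0}" using True by blast
    then have "dim (?K \<inter> {v. h v = 0}) = 0" by (simp only: dim_eq_0)
    then show ?thesis using that[OF y] by linarith
  next
    case False
    then obtain u where u: "u \<in> ?K" "u \<noteq> 0" by blast
    obtain y h where y: "smooth_point sc y" "supporting_functional sc y h" "h u \<noteq> 0"
      using smooth_point_not_vanishing_at[OF u(2)] by blast
    have "dim (?K \<inter> {v. h v = 0}) < dim ?K"
      using y(2) sub u(1) y(3) by (intro dim_kernel_less) (auto simp: supporting_functional_def)
    then show ?thesis using y that by simp
  qed
  have eq: "W \<inter> {v. \<forall>j\<in>insert i I. (g(i := h)) j v = 0} = ?K \<inter> {v. h v = 0}"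
    using insert.hyps(2) by auto
  have "subspace (?K \<inter> {v. h v = 0})"
    using y(2) by (intro subspace_inter[OF sub] subspace_kernel) (simp add: supporting_functional_def)
  moreover have "\<forall>j\<in>insert i I. smooth_point sc ((z(i := y)) j) \<and>
      supporting_functional sc ((z(i := y)) j) ((g(i := h)) j)"
    using zg y insert.hyps(2) by auto
  moreover have "dim (?K \<inter> {v. h v = 0}) \<le> dim W - card (insert i I)"
    using less dim insert.hyps by simp
  ultimately show ?case
    using eq by (intro exI[of _ "z(i := y)"] exI[of _ "g(i := h)"]) simp
qed

end

subsection \<open>The digraph of a BJ-normed space\<close>

context normed_space
begin

lemma out_nbhd_bj_digraph: "out_nbhd (bj_digraph sc) u = {v. bj_orthogonal sc u v}"
  by (simp add: out_nbhd_def bj_digraph_def)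

lemma in_nbhd_bj_digraph: "in_nbhd (bj_digraph sc) u = {v. bj_orthogonal sc v u}"
  by (simp add: in_nbhd_def bj_digraph_def)

lemma kernel_subset_out_nbhd:
  "supporting_functional sc u f \<Longrightarrow> f v = 0 \<Longrightarrow> v \<in> out_nbhd (bj_digraph sc) u"
  by (simp add: out_nbhd_bj_digraph supporting_functional_imp_bj_orthogonal)

lemma zero_in_out_nbhd: "0 \<in> out_nbhd (bj_digraph sc) u"
  by (simp add: out_nbhd_bj_digraph bj_orthogonal_def)

lemma out_nbhd_zero: "out_nbhd (bj_digraph sc) 0 = UNIV"
  by (simp add: out_nbhd_bj_digraph bj_orthogonal_def)

lemma bj_orthogonal_scale_left:
  assumes "bj_orthogonal sc u v" "k \<noteq> 0"
  shows "bj_orthogonal sc (sc k u) v"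
  unfolding bj_orthogonal_def
proof
  fix c
  have "sc k u + sc c v = sc k (u + sc (c / k) v)"
    using assms(2) by (simp add: scale_right_distrib)
  then show "norm (sc k u) \<le> norm (sc k u + sc c v)"
    using assms(1) by (simp add: norm_scale bj_orthogonal_def mult_left_mono)
qed

lemma bj_equivalent_scale:
  assumes "k \<noteq> 0"
  shows "bj_equivalent (bj_digraph sc) u (sc k u)"
proof -
  have left: "bj_orthogonal sc u v \<longleftrightarrow> bj_orthogonal sc (sc k u) v" for v
    using bj_orthogonal_scale_left[of u v k] bj_orthogonal_scale_left[of "sc k u" v "inverse k"]
      assms by auto
  have "bj_orthogonal sc v (sc l w)" if "bj_orthogonal sc v w" for v w l
    using that by (simp add: bj_orthogonal_def)
  from this[of _ u k] this[of _ "sc k u" "inverse k"]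
  have "bj_orthogonal sc v u \<longleftrightarrow> bj_orthogonal sc v (sc k u)" for v
    using assms by auto
  with left show ?thesis
    by (simp add: bj_equivalent_def out_nbhd_bj_digraph in_nbhd_bj_digraph)
qed

lemma bj_set_subset_line:
  assumes "S \<subseteq> span {v}"
  shows "bj_set (bj_digraph sc) S"
proof -
  have "bj_equivalent (bj_digraph sc) u w" if uw: "u \<in> S" "w \<in> S" "u \<noteq> 0" "w \<noteq> 0" for u w
  proof -
    obtain c where c: "u = sc c v" using uw(1) assms by (auto simp: span_singleton)
    obtain d where d: "w = sc d v" using uw(2) assms by (auto simp: span_singleton)
    from c d uw have "c \<noteq> 0" "d \<noteq> 0" by auto
    then have "w = sc (d / c) u" "d / c \<noteq> 0" using c d by simp_all
    then show ?thesis using bj_equivalent_scale by simp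
  qed
  then show ?thesis
    by (simp add: bj_set_def loopless_vertex_iff) (simp add: bj_digraph_def)
qed

end

text \<open>The converse of \<open>bj_set_subset_line\<close> for nonzero vectors; here the BJ-norm
  assumption enters.\<close>

lemma (in bj_normed_space) bj_set_proportional:
  assumes "bj_set (bj_digraph sc) S" "u \<in> S" "v \<in> S" "u \<noteq> 0" "v \<noteq> 0"
  obtains c where "c \<noteq> 0" "v = sc c u"
proof -
  have "bj_equivalent (bj_digraph sc) u v"
    using assms by (simp add: bj_set_def loopless_vertex_iff)
  then obtain a b where ab: "a \<noteq> 0 \<or> b \<noteq> 0" "sc a u + sc b v = 0"
    using bj_equivalent_imp_dependent by blast
  have "a \<noteq> 0" "b \<noteq> 0" using ab assms(4,5) by auto
  have "sc b v = sc (- a) u" using ab(2) by (simp add: eq_neg_iff_add_eq_0 add.commute)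
  then have "sc (inverse b) (sc b v) = sc (inverse b * - a) u" by simp
  then have "v = sc (inverse b * - a) u" using \<open>b \<noteq> 0\<close> by simp
  then show ?thesis using that[of "inverse b * - a"] \<open>a \<noteq> 0\<close> \<open>b \<noteq> 0\<close> by simp
qed

locale finite_dim_bj_normed_space = finite_dim_normed_space sc B + bj_normed_space sc
  for sc :: "'f::{real_normed_field, euclidean_space} \<Rightarrow> 'a::real_normed_vector \<Rightarrow> 'a" and B
begin

lemma smooth_out_nbhd:
  assumes "smooth_point sc u" "supporting_functional sc u f"
  shows "out_nbhd (bj_digraph sc) u = {v. f v = 0}"
  using assms bj_orthogonal_iff[of u] by (auto simp: out_nbhd_bj_digraph smooth_point_def)

theorem smooth_point_imp_smoothness_condition:
  assumes n: "n = dim UNIV" "n \<ge> 3" and x: "smooth_point sc x"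
  shows "smoothness_condition (bj_digraph sc) n x"
proof -
  let ?G = "bj_digraph sc"
  have x0: "x \<noteq> 0" using x by (simp add: smooth_point_def)
  then obtain f where f: "supporting_functional sc x f"
    using supporting_functional_exists by blast
  have linear: "Vector_Spaces.linear sc (*) h" if "supporting_functional sc u h" for u h
    using that by (simp add: supporting_functional_def)
  have W: "subspace {v. f v = 0}" by (rule subspace_kernel[OF linear[OF f]])
  have "f x \<noteq> 0" using supporting_functional_self[OF f] x0 by simp
  then have dimW: "dim {v. f v = 0} \<le> n - 1"
    using dim_kernel_less[OF linear[OF f] subspace_UNIV, of x] n(1) by simp
  obtain z g where z: "\<And>i. i \<in> {3..n} \<Longrightarrow> smooth_point sc (z i)"
    and g: "\<And>i. i \<in> {3..n} \<Longrightarrow> supporting_functional sc (z i) (g i)"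
    and dimK: "dim ({v. f v = 0} \<inter> {v. \<forall>i\<in>{3..n}. g i v = 0}) \<le> dim {v. f v = 0} - card {3..n}"
    using smooth_family_exists[OF finite_atLeastAtMost W x0, of 3 n] by blast
  define K where "K I = {v. f v = 0} \<inter> {v. \<forall>i\<in>I. g i v = 0}" for I
  have K_nbhd: "out_nbhd ?G x \<inter> (\<Inter>i\<in>J. out_nbhd ?G (z (\<sigma> i))) = K (\<sigma> ` J)"
    if "\<sigma> ` J \<subseteq> {3..n}" for \<sigma> J
  proof -
    have "out_nbhd ?G (z (\<sigma> i)) = {v. g (\<sigma> i) v = 0}" if "i \<in> J" for i
    proof -
      have "\<sigma> i \<in> {3..n}" using that \<open>\<sigma> ` J \<subseteq> {3..n}\<close> by blast
      then show ?thesis using z g smooth_out_nbhd by blast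
    qed
    then show ?thesis
      using smooth_out_nbhd[OF x f] by (auto simp: K_def)
  qed
  \<comment> \<open>The kernel of \<open>f\<close> has dimension at most \<open>n - 1\<close>, and
    the \<open>n - 2\<close> functionals \<open>g i\<close> leave at most 1.\<close>
  have dim1: "dim (K {3..n}) \<le> 1" using dimK dimW n(2) by (simp add: K_def)
  have line: "bj_set ?G S" if "dim S \<le> 1" for S
    using dim_le_1_subset_line[OF that] bj_set_subset_line by blast
  have "loopless_vertex ?G x" "\<forall>i\<in>{3..n}. loopless_vertex ?G (z i)"
    using x0 z by (auto simp: loopless_vertex_iff smooth_point_def)
  moreover have "bj_set ?G (out_nbhd ?G x \<inter> (\<Inter>i\<in>{3..n}. out_nbhd ?G (z i)))"
    using K_nbhd[of "\<lambda>i. i" "{3..n}"] line[OF dim1] by simp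
  moreover have "(\<Inter>i\<in>{4..n}. out_nbhd ?G (z (\<sigma> i))) \<inter> out_nbhd ?G x \<inter>
      (\<Inter>y\<in>omega_set ?G n x z \<sigma>. out_nbhd ?G y) = {0}" (is "?L = _") if \<sigma>: "\<sigma> permutes {3..n}" for \<sigma>
  proof -
    let ?I = "\<sigma> ` {4..n}"
    have img: "\<sigma> ` {3..n} = {3..n}" using \<sigma> by (rule permutes_image)
    have eq3: "{3..n} = insert 3 {4..n}" using n(2) by auto
    have I: "?I \<subseteq> {3..n}" "insert (\<sigma> 3) ?I = {3..n}" using img eq3 by auto
    have \<sigma>3: "\<sigma> 3 \<in> {3..n}" using I(2) by auto
    have subK: "subspace (K ?I)"
    proof -
      have "K ?I = {v. \<forall>h\<in>insert f (g ` ?I). h v = 0}" by (auto simp: K_def)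
      moreover have "Vector_Spaces.linear sc (*) h" if "h \<in> insert f (g ` ?I)" for h
        using that linear[OF f] linear[OF g] I(1) by blast
      ultimately show ?thesis
        using dim_common_kernel[of "insert f (g ` ?I)"] by simp
    qed
    \<comment> \<open>Only the index \<open>\<sigma> 3\<close> is missing from \<open>?I\<close>, so
      omitting its functional raises the dimension by at most one.\<close>
    have "K ?I \<inter> {v. g (\<sigma> 3) v = 0} = K {3..n}"
      unfolding I(2)[symmetric] by (auto simp: K_def)
    then have dim2: "dim (K ?I) \<le> 2"
      using dim_le_dim_kernel[OF linear[OF g[OF \<sigma>3]] subK] dim1 by simp
    have "w = 0" if w: "w \<in> ?L" for w
    proof (rule ccontr)
      \<comment> \<open>A smooth \<open>y\<close> whose functional does not vanish at
        \<open>w\<close> cuts the plane \<open>K ?I\<close> down to at most a line. Hence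
        \<open>y\<close> lies in \<open>\<Omega>\<^sub>\<sigma>\<close>, yet \<open>w\<close> is not
        in its out-neighbourhood.\<close>
      assume "w \<noteq> 0"
      then obtain y h where y: "smooth_point sc y" "supporting_functional sc y h" "h w \<noteq> 0"
        using smooth_point_not_vanishing_at by blast
      have out_y: "out_nbhd ?G y = {v. h v = 0}" by (rule smooth_out_nbhd[OF y(1,2)])
      have nb: "out_nbhd ?G x \<inter> (\<Inter>i\<in>{4..n}. out_nbhd ?G (z (\<sigma> i))) = K ?I"
        using K_nbhd I(1) by blast
      then have "w \<in> K ?I" using w by blast
      then have "dim (K ?I \<inter> {v. h v = 0}) < dim (K ?I)"
        using dim_kernel_less[OF linear[OF y(2)] subK] y(3) by blast
      then have "bj_set ?G (K ?I \<inter> {v. h v = 0})" using dim2 by (intro line) simp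
      moreover have "out_nbhd ?G x \<inter> out_nbhd ?G y \<inter> (\<Inter>i\<in>{4..n}. out_nbhd ?G (z (\<sigma> i)))
          = K ?I \<inter> {v. h v = 0}"
        using nb out_y by blast
      ultimately have "y \<in> omega_set ?G n x z \<sigma>"
        by (simp add: omega_set_def bj_digraph_def)
      then have "w \<in> out_nbhd ?G y" using w by blast
      then show False using out_y y(3) by simp
    qed
    then show ?thesis using zero_in_out_nbhd by auto
  qed
  ultimately show ?thesis unfolding smoothness_condition_def by blast
qed

text \<open>If \<open>x\<close> has two supporting functionals \<open>f, f'\<close>, then \<open>f'\<close> is a combination of \<open>f\<close> and the
  \<open>g i\<close> in which some \<open>g j\<close> occurs. Moving \<open>j\<close> to position 3, the line cut out by \<open>f\<close> and all the
  \<open>g i\<close> is orthogonal to every \<open>y \<in> \<Omega>\<close>.\<close>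

theorem smoothness_condition_imp_smooth_point:
  assumes n: "n = dim UNIV" "n \<ge> 3" and cond: "smoothness_condition (bj_digraph sc) n x"
  shows "smooth_point sc x"
proof (rule ccontr)
  assume not_smooth: "\<not> smooth_point sc x"
  let ?G = "bj_digraph sc"
  have x0: "x \<noteq> 0"
    using cond by (simp add: smoothness_condition_def loopless_vertex_iff)
  obtain z where z: "\<And>i. i \<in> {3..n} \<Longrightarrow> z i \<noteq> 0"
    and bj: "bj_set ?G (out_nbhd ?G x \<inter> (\<Inter>i\<in>{3..n}. out_nbhd ?G (z i)))" (is "bj_set _ ?T")
    and perm: "\<And>\<sigma>. \<sigma> permutes {3..n} \<Longrightarrow> (\<Inter>i\<in>{4..n}. out_nbhd ?G (z (\<sigma> i))) \<inter> out_nbhd ?G x \<inter>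
             (\<Inter>y\<in>omega_set ?G n x z \<sigma>. out_nbhd ?G y) = {0}"
    using cond unfolding smoothness_condition_def loopless_vertex_iff by blast
  have "\<forall>i\<in>{3..n}. \<exists>h. supporting_functional sc (z i) h"
    using z supporting_functional_exists by blast
  then obtain g where g: "\<And>i. i \<in> {3..n} \<Longrightarrow> supporting_functional sc (z i) (g i)"
    by metis
  obtain f where f: "supporting_functional sc x f"
    using supporting_functional_exists[OF x0] by blast
  with not_smooth x0 obtain f' where f': "supporting_functional sc x f'" "f' \<noteq> f"
    unfolding smooth_point_def by blast
  have linear: "Vector_Spaces.linear sc (*) h" if "supporting_functional sc u h" for u h
    using that by (simp add: supporting_functional_def)
  have zero_iff: "h (sc c v) = 0 \<longleftrightarrow> h v = 0"
    if "supporting_functional sc u h" "c \<noteq> 0" for u h c v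
    using that by (simp add: supporting_functional_scale)
  let ?F = "\<lambda>\<phi>. insert \<phi> (g ` {3..n})"
  have F_T: "v \<in> ?T" if "supporting_functional sc x \<phi>" "\<forall>h\<in>?F \<phi>. h v = 0" for \<phi> v
    using that by (auto intro: kernel_subset_out_nbhd[OF g] kernel_subset_out_nbhd)
  \<comment> \<open>At most \<open>1 + (n - 2)\<close> functionals in dimension \<open>n\<close>
    leave a nonzero common zero.\<close>
  have F_zero: "\<exists>v. v \<noteq> 0 \<and> (\<forall>h\<in>?F \<phi>. h v = 0)" if \<phi>: "supporting_functional sc x \<phi>" for \<phi>
  proof (rule common_zero_exists)
    have "card (?F \<phi>) \<le> Suc (card (g ` {3..n}))" by (rule card_insert_le_m1) simp_all
    also have "\<dots> \<le> Suc (card {3..n})" by (simp add: card_image_le del: card_atLeastAtMost)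
    finally show "card (?F \<phi>) < dim UNIV" using n by simp
  qed (use linear[OF \<phi>] linear[OF g] in auto)
  obtain l where l: "l \<noteq> 0" "\<forall>h\<in>?F f. h l = 0" using F_zero[OF f] by blast
  obtain l' where l': "l' \<noteq> 0" "\<forall>h\<in>?F f'. h l' = 0" using F_zero[OF f'(1)] by blast
  have lT: "l \<in> ?T" using F_T[OF f l(2)] .
  have T_line: "\<exists>c. c \<noteq> 0 \<and> v = sc c l" if "v \<in> ?T" "v \<noteq> 0" for v
    using bj_set_proportional[OF bj lT that(1) l(1) that(2)] by blast
  \<comment> \<open>Both \<open>l\<close> and \<open>l'\<close> lie in the BJ-set \<open>?T\<close>,
    so they are proportional, and \<open>f'\<close> kills \<open>l'\<close>.\<close>
  have f'l: "f' l = 0"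
    using T_line[OF F_T[OF f'(1) l'(2)] l'(1)] l'(2) zero_iff[OF f'(1)] by auto
  have "f' v = 0" if "\<forall>h\<in>?F f. h v = 0" for v
  proof (cases "v = 0")
    case True
    then show ?thesis using linear_functional_zero[OF linear[OF f'(1)]] by simp
  next
    case False
    then show ?thesis using T_line[OF F_T[OF f that]] f'l zero_iff[OF f'(1)] by auto
  qed
  moreover have "Vector_Spaces.linear sc (*) h" if "h \<in> ?F f" for h
    using that linear[OF f] linear[OF g] by blast
  ultimately obtain b where b: "\<And>v. f' v = (\<Sum>h\<in>?F f. b h * h v)"
    using functional_in_span[of "?F f" f'] linear[OF f'(1)] by auto
  \<comment> \<open>Otherwise \<open>f'\<close> is a multiple of \<open>f\<close>; as both take the
    value \<open>norm x\<close> at \<open>x\<close>, they would coincide.\<close>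
  have "\<exists>h\<in>?F f - {f}. b h \<noteq> 0"
  proof (rule ccontr)
    assume "\<not> ?thesis"
    then have multiple: "f' v = b f * f v" for v
      unfolding b[of v] by (subst sum.remove[of _ f]) (auto intro: sum.neutral)
    from multiple[of x] have "b f = 1"
      using x0 by (simp add: supporting_functional_self[OF f] supporting_functional_self[OF f'(1)])
    with multiple have "f' = f" by auto
    with f'(2) show False by simp
  qed
  then obtain j where j: "j \<in> {3..n}" "b (g j) \<noteq> 0" by blast
  define \<sigma> where "\<sigma> = Transposition.transpose 3 j"
  define P where "P = {3..n} - {j}"
  have \<sigma>: "\<sigma> permutes {3..n}"
    unfolding \<sigma>_def using j(1) n(2) by (intro permutes_swap_id) auto
  have img: "\<sigma> ` {4..n} = P"
  proof -
    have "{4..n} = {3..n} - {3}" by auto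
    then have "\<sigma> ` {4..n} = \<sigma> ` {3..n} - {\<sigma> 3}"
      using inj_on_image_set_diff[of \<sigma> UNIV "{3..n}" "{3}"] permutes_inj[OF \<sigma>] by simp
    then show ?thesis using permutes_image[OF \<sigma>] by (simp add: \<sigma>_def P_def)
  qed
  have INT_P: "(\<Inter>i\<in>{4..n}. out_nbhd ?G (z (\<sigma> i))) = (\<Inter>i\<in>P. out_nbhd ?G (z i))"
    unfolding img[symmetric] by simp
  \<comment> \<open>Solve the relation \<open>b\<close> for \<open>g j\<close>. The sum ranges over
    a set of functionals, so every summand other than that of \<open>g j\<close> belongs to
    \<open>f\<close> or to some \<open>g i\<close> with \<open>i\<close> in \<open>P\<close>, even
    if the family \<open>g\<close> has repetitions.\<close>
  have gj: "g j v = 0" if v: "f v = 0" "f' v = 0" "\<And>i. i \<in> P \<Longrightarrow> g i v = 0" for v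
  proof -
    have "f' v = b (g j) * g j v + (\<Sum>h\<in>?F f - {g j}. b h * h v)"
      unfolding b[of v] using j(1) by (intro sum.remove) auto
    also have "(\<Sum>h\<in>?F f - {g j}. b h * h v) = 0"
    proof (intro sum.neutral ballI)
      fix h assume "h \<in> ?F f - {g j}"
      then have "h = f \<or> (\<exists>i\<in>P. h = g i)" by (auto simp: P_def)
      then show "b h * h v = 0" using v(1,3) by auto
    qed
    finally show ?thesis using v(2) j(2) by simp
  qed
  have "l \<in> out_nbhd ?G y" if y: "y \<in> omega_set ?G n x z \<sigma>" for y
  proof (cases "y = 0")
    case True
    then show ?thesis by (simp add: out_nbhd_zero)
  next
    case False
    then obtain h where h: "supporting_functional sc y h"
      using supporting_functional_exists by blast
    have bj_y: "bj_set ?G (out_nbhd ?G x \<inter> out_nbhd ?G y \<inter> (\<Inter>i\<in>P. out_nbhd ?G (z i)))"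
      (is "bj_set _ ?S") using y unfolding omega_set_def INT_P by simp
    \<comment> \<open>Here the count is at most \<open>2 + (n - 3)\<close> functionals, again below
      \<open>n\<close>.\<close>
    have zero: "\<exists>m. m \<noteq> 0 \<and> \<phi> m = 0 \<and> h m = 0 \<and> (\<forall>i\<in>P. g i m = 0) \<and> m \<in> ?S"
      if \<phi>: "supporting_functional sc x \<phi>" for \<phi>
    proof -
      let ?E = "insert \<phi> (insert h (g ` P))"
      have "\<exists>m. m \<noteq> 0 \<and> (\<forall>e\<in>?E. e m = 0)"
      proof (rule common_zero_exists)
        have "card ?E \<le> Suc (card (insert h (g ` P)))"
          by (rule card_insert_le_m1) (simp_all add: P_def)
        also have "card (insert h (g ` P)) \<le> Suc (card (g ` P))"
          by (rule card_insert_le_m1) (simp_all add: P_def)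
        also have "card (g ` P) \<le> card P" by (simp add: card_image_le P_def)
        finally have "card ?E \<le> Suc (Suc (card P))" by simp
        moreover have "card P = n - 3" using j(1) by (simp add: P_def)
        ultimately show "card ?E < dim UNIV" using n by linarith
      qed (use linear[OF \<phi>] linear[OF h] linear[OF g] in \<open>auto simp: P_def\<close>)
      then obtain m where m: "m \<noteq> 0" "\<forall>e\<in>?E. e m = 0" by blast
      moreover have "m \<in> ?S"
        using m(2) by (auto simp: P_def intro: kernel_subset_out_nbhd[OF g]
            kernel_subset_out_nbhd[OF h] kernel_subset_out_nbhd[OF \<phi>])
      ultimately show ?thesis by blast
    qed
    obtain m where m: "m \<noteq> 0" "f m = 0" "h m = 0" "\<forall>i\<in>P. g i m = 0" "m \<in> ?S"
      using zero[OF f] by blast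
    obtain m' where m': "m' \<noteq> 0" "f' m' = 0" "m' \<in> ?S"
      using zero[OF f'(1)] by blast
    \<comment> \<open>The zeros obtained from \<open>f\<close> and from \<open>f'\<close> are
      proportional in the BJ-set \<open>?S\<close>, so \<open>m\<close> is killed by both, hence by
      \<open>g j\<close>. This puts \<open>m\<close> on the line of \<open>l\<close>, and
      \<open>h m = 0\<close> carries over to \<open>l\<close>.\<close>
    obtain c where "c \<noteq> 0" "m' = sc c m"
      using bj_set_proportional[OF bj_y m(5) m'(3) m(1) m'(1)] .
    then have "f' m = 0" using m'(2) zero_iff[OF f'(1)] by auto
    then have "g j m = 0" using gj m by blast
    then have "\<forall>e\<in>?F f. e m = 0" using m(2,4) by (auto simp: P_def)
    then obtain d where "d \<noteq> 0" "m = sc d l" using T_line[OF F_T[OF f] m(1)] by blast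
    then have "h l = 0" using m(3) zero_iff[OF h] by auto
    then show ?thesis by (rule kernel_subset_out_nbhd[OF h])
  qed
  moreover have "l \<in> (\<Inter>i\<in>P. out_nbhd ?G (z i)) \<inter> out_nbhd ?G x" using lT by (auto simp: P_def)
  ultimately have "l = 0" using perm[OF \<sigma>] unfolding INT_P by blast
  with l(1) show False by simp
qed

end

section \<open>The equivalence and its real and complex instances\<close>

theorem smooth_point_iff_smoothness_condition:
  fixes sc :: "'f::{real_normed_field, euclidean_space} \<Rightarrow> 'a::real_normed_vector \<Rightarrow> 'a"
  assumes "bj_normed_space sc" "finite_dimensional_vector_space sc B"
    and n: "n = vector_space.dim sc UNIV" "n \<ge> 3"
  shows "smooth_point sc x \<longleftrightarrow> smoothness_condition (bj_digraph sc) n x"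
proof -
  interpret bj_normed_space sc by fact
  interpret finite_dimensional_vector_space sc B by fact
  interpret finite_dim_bj_normed_space sc B by unfold_locales
  show ?thesis
    using smooth_point_imp_smoothness_condition smoothness_condition_imp_smooth_point n by blast
qed

theorem corollary3p6:
  fixes scaleC :: "complex \<Rightarrow> 'b::real_normed_vector \<Rightarrow> 'b"
  shows
    "(bj_normed_space (scaleR :: real \<Rightarrow> 'a::real_normed_vector \<Rightarrow> 'a) \<longrightarrow>
        (\<exists>B. finite_dimensional_vector_space (scaleR :: real \<Rightarrow> 'a \<Rightarrow> 'a) B) \<longrightarrow>
        (\<forall>n. n = vector_space.dim (scaleR :: real \<Rightarrow> 'a \<Rightarrow> 'a) UNIV \<and> n \<ge> 3 \<longrightarrow>
           (\<forall>x. smooth_point (scaleR :: real \<Rightarrow> 'a \<Rightarrow> 'a) x \<longleftrightarrow>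
                smoothness_condition (bj_digraph (scaleR :: real \<Rightarrow> 'a \<Rightarrow> 'a)) n x))) \<and>
     (bj_normed_space scaleC \<longrightarrow>
        (\<exists>B. finite_dimensional_vector_space scaleC B) \<longrightarrow>
        (\<forall>n. n = vector_space.dim scaleC UNIV \<and> n \<ge> 3 \<longrightarrow>
           (\<forall>x. smooth_point scaleC x \<longleftrightarrow>
                smoothness_condition (bj_digraph scaleC) n x)))"
  by (intro conjI impI allI; elim exE conjE)
    (rule smooth_point_iff_smoothness_condition; assumption)+

end
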